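(* Let $R$ be a commutative ring with unity. Let $k\in\mathbb{N}$ and let $I_0,\ldots,I_k$ be mutually co-maximal ideals of $R$, each of which is contained in only finitely many maximal ideals. Let $m^i_j\in\mathbb{N}$, $0\le i,j\le k$, be such that for some permutation $\sigma$ of $\{0,1,\ldots,k\}$ we have $m^i_{\sigma(i)}=1$ for each $0\le i\le k$. Then the map $$SL_{k+1}(R)\longrightarrow\prod_{i=0}^{k}\mathbb{PF}^{k,(m^i_0,m^i_1,\ldots,m^i_k)}_{I_i}$$ given by $$[a_{i,j}]_{0\le i,j\le k}\longmapsto\big([a_{0,0}:a_{0,1}:\cdots:a_{0,k}],[a_{1,0}:a_{1,1}:\cdots:a_{1,k}],\ldots,[a_{k,0}:a_{k,1}:\cdots:a_{k,k}]\big)$$ is surjective. In particular: (1) If $m^i_j=1$ for all $0\le i,j\le k$ (the case of usual projective spaces), the map is surjective. (2) Let $I_0,\ldots,I_k$ be pairwise co-maximal ideals of $R$ such that for each $0\le i\le k$ either $I_i=R$ or $I_i=Q_{i1}Q_{i2}\cdots Q_{ir_i}$, where the $Q_{ij}$ are ideals with $\mathrm{rad}(Q_{ij})=M_{ij}$ and the $M_{ij}$ ($1\le j\le r_i$, $0\le i\le k$) are distinct maximal ideals of $R$. Let $m^i_j\in\mathbb{N}$, $0\le i,j\le k$, be such that for some permutation $\sigma$ of $\{0,1,\ldots,k\}$ we have $m^i_{\sigma(i)}=1$ for each $0\le i\le k$. Then the map $SL_{k+1}(R)\to\prod_{i=0}^{k}\mathbb{PF}^{k,(m^i_0,\ldots,m^i_k)}_{I_i}$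 given by the same formula is surjective.
   Context: $\mathbb{N}$ denotes the positive integers. Ideals are mutually (pairwise) co-maximal if any two with distinct indices sum to $R$; the unit ideal $R$ is allowed. For $k\in\mathbb{N}$, let $\mathcal{GCD}_{k+1}(R)=\{(a_0,\ldots,a_k)\in R^{k+1} : \sum_{i=0}^{k}(a_i)=R\}$. For a proper ideal $I\subsetneq R$ and $m_0,\ldots,m_k\in\mathbb{N}$, define an equivalence relation on $\mathcal{GCD}_{k+1}(R)$ by $(a_0,\ldots,a_k)\sim(b_0,\ldots,b_k)$ iff there is $\lambda\in R$ whose image in $R/I$ is a unit such that $a_i\equiv\lambda^{m_i}b_i\bmod I$ for all $0\le i\le k$. If $I=R$, any two elements are declared equivalent. The generalized projective space $\mathbb{PF}^{k,(m_0,\ldots,m_k)}_{I}$ is the quotient set of $\mathcal{GCD}_{k+1}(R)$ by this relation (a singleton if $I=R$); the class of $(a_0,\ldots,a_k)$ is written $[a_0:\cdots:a_k]$. $SL_{k+1}(R)$ is the group of $(k+1)\times(k+1)$ matrices over $R$ with determinant $1$. *)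

theory Defs
  imports "HOL-Algebra.Algebra" "HOL-Combinatorics.Permutations"
begin

text \<open>
  Tuples indexed by \<open>0, \<dots>, k\<close> are extensional functions on \<open>{..k}\<close>; a square matrix of size
  \<open>k + 1\<close> is the tuple of its rows, so that \<open>A i\<close> is row \<open>i\<close>. The ring may be the zero ring.
\<close>

definition tuples :: "('a, 'b) ring_scheme \<Rightarrow> nat \<Rightarrow> (nat \<Rightarrow> 'a) set"
  where "tuples R k = ({..k} \<rightarrow>\<^sub>E carrier R)"

text \<open>The sum of the principal ideals is taken in the semiring of ideals of \<open>R\<close>.\<close>

definition GCD_tuples :: "('a, 'b) ring_scheme \<Rightarrow> nat \<Rightarrow> (nat \<Rightarrow> 'a) set"
  where "GCD_tuples R k =
    {a \<in> tuples R k. (\<Oplus>\<^bsub>ideals_set R\<^esub> i \<in> {..k}. PIdl\<^bsub>R\<^esub> (a i)) = carrier R}"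

definition PF_rel ::
    "('a, 'b) ring_scheme \<Rightarrow> nat \<Rightarrow> (nat \<Rightarrow> nat) \<Rightarrow> 'a set \<Rightarrow> ((nat \<Rightarrow> 'a) \<times> (nat \<Rightarrow> 'a)) set"
  where "PF_rel R k m I =
    {(a, b). a \<in> GCD_tuples R k \<and> b \<in> GCD_tuples R k \<and>
      (I = carrier R \<or>
       (\<exists>l \<in> carrier R. I +>\<^bsub>R\<^esub> l \<in> Units (R Quot I) \<and>
          (\<forall>i\<le>k. a i \<ominus>\<^bsub>R\<^esub> (l [^]\<^bsub>R\<^esub> m i) \<otimes>\<^bsub>R\<^esub> b i \<in> I)))}"

definition PF :: "('a, 'b) ring_scheme \<Rightarrow> nat \<Rightarrow> (nat \<Rightarrow> nat) \<Rightarrow> 'a set \<Rightarrow> (nat \<Rightarrow> 'a) set set"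
  where "PF R k m I = GCD_tuples R k // PF_rel R k m I"

definition PF_class ::
    "('a, 'b) ring_scheme \<Rightarrow> nat \<Rightarrow> (nat \<Rightarrow> nat) \<Rightarrow> 'a set \<Rightarrow> (nat \<Rightarrow> 'a) \<Rightarrow> (nat \<Rightarrow> 'a) set"
  where "PF_class R k m I a = PF_rel R k m I `` {a}"

definition determinant :: "('a, 'b) ring_scheme \<Rightarrow> nat \<Rightarrow> (nat \<Rightarrow> nat \<Rightarrow> 'a) \<Rightarrow> 'a"
  where "determinant R k A =
    (\<Oplus>\<^bsub>R\<^esub> p \<in> {p. p permutes {..k}}.
       (if evenperm p then \<one>\<^bsub>R\<^esub> else \<ominus>\<^bsub>R\<^esub> \<one>\<^bsub>R\<^esub>) \<otimes>\<^bsub>R\<^esub> (\<Otimes>\<^bsub>R\<^esub> i \<in> {..k}. A i (p i)))"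

definition SL :: "('a, 'b) ring_scheme \<Rightarrow> nat \<Rightarrow> (nat \<Rightarrow> nat \<Rightarrow> 'a) set"
  where "SL R k = {A \<in> {..k} \<rightarrow>\<^sub>E tuples R k. determinant R k A = \<one>\<^bsub>R\<^esub>}"

definition row_map ::
    "('a, 'b) ring_scheme \<Rightarrow> nat \<Rightarrow> (nat \<Rightarrow> nat \<Rightarrow> nat) \<Rightarrow> (nat \<Rightarrow> 'a set) \<Rightarrow>
     (nat \<Rightarrow> nat \<Rightarrow> 'a) \<Rightarrow> nat \<Rightarrow> (nat \<Rightarrow> 'a) set"
  where "row_map R k m I A = (\<lambda>i\<in>{..k}. PF_class R k (m i) (I i) (A i))"

definition comaximal_ideals :: "('a, 'b) ring_scheme \<Rightarrow> nat \<Rightarrow> (nat \<Rightarrow> 'a set) \<Rightarrow> bool"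
  where "comaximal_ideals R k I \<longleftrightarrow>
    (\<forall>i\<le>k. ideal (I i) R) \<and>
    (\<forall>i\<le>k. \<forall>j\<le>k. i \<noteq> j \<longrightarrow> I i <+>\<^bsub>R\<^esub> I j = carrier R)"

definition finitely_many_maximal_over :: "('a, 'b) ring_scheme \<Rightarrow> 'a set \<Rightarrow> bool"
  where "finitely_many_maximal_over R I \<longleftrightarrow> finite {M. maximalideal M R \<and> I \<subseteq> M}"

definition admissible_weights :: "nat \<Rightarrow> (nat \<Rightarrow> nat \<Rightarrow> nat) \<Rightarrow> bool"
  where "admissible_weights k m \<longleftrightarrow>
    (\<forall>i\<le>k. \<forall>j\<le>k. 1 \<le> m i j) \<and>
    (\<exists>s. s permutes {..k} \<and> (\<forall>i\<le>k. m i (s i) = 1))"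

definition ideal_radical :: "('a, 'b) ring_scheme \<Rightarrow> 'a set \<Rightarrow> 'a set"
  where "ideal_radical R Q = {x \<in> carrier R. \<exists>n::nat. 1 \<le> n \<and> x [^]\<^bsub>R\<^esub> n \<in> Q}"

text \<open>
  The data \<open>Q i j\<close>, \<open>M i j\<close> and \<open>r i\<close> only matter for those \<open>i\<close> with \<open>I i \<noteq> R\<close>; distinctness of
  the maximal ideals is required across all pairs \<open>(i, j)\<close> that occur.
\<close>

definition primary_type_products :: "('a, 'b) ring_scheme \<Rightarrow> nat \<Rightarrow> (nat \<Rightarrow> 'a set) \<Rightarrow> bool"
  where "primary_type_products R k I \<longleftrightarrow>
    (\<exists>(r :: nat \<Rightarrow> nat) Q M.
      (\<forall>i\<le>k. I i = carrier R \<or>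
        (1 \<le> r i \<and>
         (\<forall>j\<in>{1..r i}. ideal (Q i j) R \<and> maximalideal (M i j) R \<and>
            ideal_radical R (Q i j) = M i j) \<and>
         I i = (\<Otimes>\<^bsub>ideals_set R\<^esub> j \<in> {1..r i}. Q i j))) \<and>
      inj_on (\<lambda>(i, j). M i j) (SIGMA i:{i. i \<le> k \<and> I i \<noteq> carrier R}. {1..r i}))"

lemma (in cring) equiv_PF_rel:
  assumes I: "ideal I R"
  shows "equiv (GCD_tuples R k) (PF_rel R k m I)"
proof (cases "I = carrier R")
  case True
  then show ?thesis
    unfolding PF_rel_def by (auto intro!: equivI refl_onI symI transI)
next
  case False
  interpret I: ideal I R by (rule I)
  interpret Q: cring "R Quot I" by (rule I.quotient_is_cring[OF is_cring])
  interpret h: ring_hom_ring R "R Quot I" "(+>) I" by (rule I.rcos_ring_hom_ring)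
  have carr: "a i \<in> carrier R" if "a \<in> GCD_tuples R k" "i \<le> k" for a i
    using that by (auto simp: GCD_tuples_def tuples_def)
  have cong_iff: "x \<ominus> y \<in> I \<longleftrightarrow> I +> x = I +> y" if "x \<in> carrier R" "y \<in> carrier R" for x y
    using that by (rule quotient_eq_iff_same_a_r_cos[OF I])
  have pow: "I +> (x [^] n) = (I +> x) [^]\<^bsub>R Quot I\<^esub> n" if "x \<in> carrier R" for x and n :: nat
    using that by (induction n) (simp_all add: h.hom_mult)
  have rel: "(a, b) \<in> PF_rel R k m I \<longleftrightarrow> a \<in> GCD_tuples R k \<and> b \<in> GCD_tuples R k \<and>
      (\<exists>u \<in> Units (R Quot I). \<forall>i\<le>k. I +> a i = (u [^]\<^bsub>R Quot I\<^esub> m i) \<otimes>\<^bsub>R Quot I\<^esub> (I +> b i))"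
    (is "_ \<longleftrightarrow> ?rhs") for a b
  proof -
    have step: "a i \<ominus> (l [^] m i) \<otimes> b i \<in> I \<longleftrightarrow>
        I +> a i = ((I +> l) [^]\<^bsub>R Quot I\<^esub> m i) \<otimes>\<^bsub>R Quot I\<^esub> (I +> b i)"
      if "a \<in> GCD_tuples R k" "b \<in> GCD_tuples R k" "l \<in> carrier R" "i \<le> k" for i l
    proof -
      have "a i \<in> carrier R" "b i \<in> carrier R" using that carr by blast+
      with that(3) show ?thesis by (simp add: cong_iff h.hom_mult pow)
    qed
    have repr: "\<exists>l\<in>carrier R. u = I +> l" if "u \<in> Units (R Quot I)" for u
    proof -
      have "u \<in> a_rcosets I"
        using Q.Units_closed[OF that] unfolding FactRing_def partial_object.simps .
      then show ?thesis
        unfolding A_RCOSETS_def RCOSETS_def a_r_coset_def by auto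
    qed
    show ?thesis
    proof (cases "a \<in> GCD_tuples R k \<and> b \<in> GCD_tuples R k")
      case True
      then have "(a, b) \<in> PF_rel R k m I \<longleftrightarrow> (\<exists>l\<in>carrier R. I +> l \<in> Units (R Quot I) \<and>
          (\<forall>i\<le>k. I +> a i = ((I +> l) [^]\<^bsub>R Quot I\<^esub> m i) \<otimes>\<^bsub>R Quot I\<^esub> (I +> b i)))"
        unfolding PF_rel_def using False step by (simp cong: conj_cong bex_cong)
      also have "\<dots> \<longleftrightarrow> (\<exists>u\<in>Units (R Quot I).
          \<forall>i\<le>k. I +> a i = (u [^]\<^bsub>R Quot I\<^esub> m i) \<otimes>\<^bsub>R Quot I\<^esub> (I +> b i))"
        using repr by blast
      finally show ?thesis using True by blast
    qed (auto simp: PF_rel_def)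
  qed
  show ?thesis
  proof (rule equivI)
    show "PF_rel R k m I \<subseteq> GCD_tuples R k \<times> GCD_tuples R k" by (auto simp: PF_rel_def)
    show "refl_on (GCD_tuples R k) (PF_rel R k m I)"
    proof (rule refl_onI)
      fix a assume a: "a \<in> GCD_tuples R k"
      then show "(a, a) \<in> PF_rel R k m I"
        unfolding rel by (auto intro!: bexI[of _ "\<one>\<^bsub>R Quot I\<^esub>"] simp: carr)
    qed
    show "sym (PF_rel R k m I)"
    proof (rule symI)
      fix a b assume "(a, b) \<in> PF_rel R k m I"
      then obtain u where ab: "a \<in> GCD_tuples R k" "b \<in> GCD_tuples R k"
        and u: "u \<in> Units (R Quot I)"
        and eq: "\<And>i. i \<le> k \<Longrightarrow> I +> a i = (u [^]\<^bsub>R Quot I\<^esub> m i) \<otimes>\<^bsub>R Quot I\<^esub> (I +> b i)"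
        unfolding rel by blast
      let ?v = "inv\<^bsub>R Quot I\<^esub> u"
      have "I +> b i = (?v [^]\<^bsub>R Quot I\<^esub> m i) \<otimes>\<^bsub>R Quot I\<^esub> (I +> a i)" if "i \<le> k" for i
      proof -
        have "(?v [^]\<^bsub>R Quot I\<^esub> m i) \<otimes>\<^bsub>R Quot I\<^esub> (u [^]\<^bsub>R Quot I\<^esub> m i) = \<one>\<^bsub>R Quot I\<^esub>"
          using Q.nat_pow_distrib[of ?v u "m i"] u Q.Units_closed[OF u] by simp
        moreover have "I +> b i \<in> carrier (R Quot I)"
          using carr[OF ab(2) that] by (rule h.hom_closed)
        ultimately show ?thesis
          using u Q.Units_closed[OF u] eq[OF that] Q.m_assoc[of "?v [^]\<^bsub>R Quot I\<^esub> m i" "u [^]\<^bsub>R Quot I\<^esub> m i" "I +> b i"]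
          by simp
      qed
      then show "(b, a) \<in> PF_rel R k m I"
        unfolding rel using ab u by (auto intro!: bexI[of _ ?v])
    qed
    show "trans (PF_rel R k m I)"
    proof (rule transI)
      fix a b c assume "(a, b) \<in> PF_rel R k m I" "(b, c) \<in> PF_rel R k m I"
      then obtain u v where abc: "a \<in> GCD_tuples R k" "b \<in> GCD_tuples R k" "c \<in> GCD_tuples R k"
        and uv: "u \<in> Units (R Quot I)" "v \<in> Units (R Quot I)"
        and eq: "\<And>i. i \<le> k \<Longrightarrow> I +> a i = (u [^]\<^bsub>R Quot I\<^esub> m i) \<otimes>\<^bsub>R Quot I\<^esub> (I +> b i)"
          "\<And>i. i \<le> k \<Longrightarrow> I +> b i = (v [^]\<^bsub>R Quot I\<^esub> m i) \<otimes>\<^bsub>R Quot I\<^esub> (I +> c i)"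
        unfolding rel by blast
      have "I +> a i = ((u \<otimes>\<^bsub>R Quot I\<^esub> v) [^]\<^bsub>R Quot I\<^esub> m i) \<otimes>\<^bsub>R Quot I\<^esub> (I +> c i)"
        if "i \<le> k" for i
      proof -
        have "I +> c i \<in> carrier (R Quot I)"
          using carr[OF abc(3) that] by (rule h.hom_closed)
        then show ?thesis
          using uv[THEN Q.Units_closed] eq[OF that] by (simp add: Q.nat_pow_distrib Q.m_assoc)
      qed
      then show "(a, c) \<in> PF_rel R k m I"
        unfolding rel using abc uv by (auto intro!: bexI[of _ "u \<otimes>\<^bsub>R Quot I\<^esub> v"])
    qed
  qed
qed

end

theory Submission
  imports Defs
begin

text \<open>
  Choose unimodular representatives \<open>x 0, \<dots>, x k\<close> of the given classes. The claim follows from a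
  lifting statement: there is a matrix \<open>A\<close> of determinant one whose row \<open>i\<close> is congruent to \<open>x i\<close>
  modulo \<open>I i\<close>, for all \<open>i\<close> at once. Such a congruence is an equivalence of representatives with
  scalar \<open>\<lambda> = \<one>\<close>, all of whose powers are \<open>\<one>\<close>.

  For a single ideal \<open>J\<close> contained in finitely many maximal ideals, the quotient by \<open>J\<close> is
  semilocal, and over a semilocal ring elementary column operations carry a unit row to any unimodular
  row of length at least two (\<open>unimodular_elementary_induct\<close>). The reason is the stable range property
  \<open>avoid_maximalideals\<close>: if two elements do not both lie in any one of finitely many maximal
  ideals, then a suitable combination \<open>a \<oplus> c \<otimes> b\<close> avoids all of them.

  The rows are made independent by comaximality. The Chinese remainder theorem
  (\<open>exists_indicator_mod_ideals\<close>) allows the coefficient of a column operation to be prescribed modulo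
  \<open>I i\<close> and to vanish modulo the other ideals, so that, up to the congruences, the operation touches
  row \<open>i\<close> only. Starting from the identity matrix, the rows are therefore adjusted one after the
  other by column operations, which preserve the determinant (\<open>determinant_col_op\<close>).

  An ideal that is a product of ideals with maximal radicals lies in finitely many maximal ideals
  (\<open>primary_type_products_finitely_many_maximal\<close>), which reduces the last assertion to the first.
\<close>

section \<open>Determinants over a commutative ring\<close>

context cring
begin

abbreviation sgn_of :: "(nat \<Rightarrow> nat) \<Rightarrow> 'a"
  where "sgn_of p \<equiv> (if evenperm p then \<one> else \<ominus> \<one>)"

lemma determinant_cong:
  assumes "\<And>i j. i \<le> k \<Longrightarrow> j \<le> k \<Longrightarrow> A i j \<in> carrier R"
    and "\<And>i j. i \<le> k \<Longrightarrow> j \<le> k \<Longrightarrow> A i j = B i j"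
  shows "determinant R k A = determinant R k B"
proof -
  have "(\<Otimes>i\<in>{..k}. A i (p i)) = (\<Otimes>i\<in>{..k}. B i (p i))" "(\<Otimes>i\<in>{..k}. B i (p i)) \<in> carrier R"
    if "p permutes {..k}" for p
  proof -
    have "p i \<le> k" if "i \<le> k" for i
      using permutes_in_image[OF \<open>p permutes {..k}\<close>, of i] that by simp
    with assms show "(\<Otimes>i\<in>{..k}. A i (p i)) = (\<Otimes>i\<in>{..k}. B i (p i))"
        "(\<Otimes>i\<in>{..k}. B i (p i)) \<in> carrier R"
      by (auto intro!: finprod_cong' finprod_closed simp: Pi_def)
  qed
  then show ?thesis
    unfolding determinant_def by (intro finsum_cong') auto
qed

lemma determinant_closed:
  assumes A: "\<And>i j. i \<le> k \<Longrightarrow> j \<le> k \<Longrightarrow> A i j \<in> carrier R"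
  shows "determinant R k A \<in> carrier R"
proof -
  have "p i \<le> k" if "p permutes {..k}" "i \<le> k" for p i
    using permutes_in_image[OF that(1), of i] that(2) by simp
  then show ?thesis
    unfolding determinant_def by (auto intro!: finsum_closed finprod_closed A)
qed

text \<open>
  Reindexing both the sum and the products by inverse permutations. It transfers the multilinear
  and alternating laws, which the definition makes natural for rows, to columns.
\<close>
lemma determinant_transpose:
  assumes A: "\<And>i j. i \<le> k \<Longrightarrow> j \<le> k \<Longrightarrow> A i j \<in> carrier R"
  shows "determinant R k (\<lambda>i j. A j i) = determinant R k A"
proof -
  let ?P = "{p. p permutes {..k}}"
  let ?f = "\<lambda>p. sgn_of p \<otimes> (\<Otimes>i\<in>{..k}. A i (p i))"
  have le: "p i \<le> k" if "p permutes {..k}" "i \<le> k" for p i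
    using permutes_in_image[OF that(1), of i] that(2) by simp
  have prods: "(\<Otimes>i\<in>{..k}. A i (p i)) \<in> carrier R" if "p permutes {..k}" for p
    by (auto intro!: finprod_closed A le[OF that])
  have inv_img: "Hilbert_Choice.inv ` ?P = ?P"
    using image_inverse_permutations by (auto simp: Setcompr_eq_image)
  have "determinant R k A = finsum R ?f (Hilbert_Choice.inv ` ?P)"
    unfolding determinant_def inv_img ..
  also have "\<dots> = finsum R (\<lambda>p. ?f (Hilbert_Choice.inv p)) ?P"
  proof (rule finsum_reindex)
    show "?f \<in> Hilbert_Choice.inv ` ?P \<rightarrow> carrier R"
      unfolding inv_img using prods by auto
    show "inj_on Hilbert_Choice.inv ?P"
      by (metis (mono_tags, lifting) inj_onI mem_Collect_eq permutes_inv_inv)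
  qed
  also have "\<dots> = determinant R k (\<lambda>i j. A j i)"
    unfolding determinant_def
  proof (rule finsum_cong'[OF refl])
    show "(\<lambda>p. sgn_of p \<otimes> (\<Otimes>i\<in>{..k}. A (p i) i)) \<in> ?P \<rightarrow> carrier R"
    proof
      fix p assume "p \<in> ?P"
      then have "p permutes {..k}" by simp
      note le[OF this]
      then show "sgn_of p \<otimes> (\<Otimes>i\<in>{..k}. A (p i) i) \<in> carrier R"
        by (auto intro!: finprod_closed A)
    qed
    fix p assume "p \<in> ?P"
    then have p: "p permutes {..k}" by simp
    note ip = permutes_inv[OF p]
    have "(\<Otimes>i\<in>{..k}. A i (Hilbert_Choice.inv p i)) = (\<Otimes>i\<in>p ` {..k}. A i (Hilbert_Choice.inv p i))"
      by (simp add: permutes_image[OF p])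
    also have "\<dots> = (\<Otimes>i\<in>{..k}. A (p i) (Hilbert_Choice.inv p (p i)))"
      by (rule finprod_reindex)
        (auto simp: permutes_image[OF p] intro!: A le[OF ip] permutes_inj_on[OF p] le[OF p])
    finally have "(\<Otimes>i\<in>{..k}. A i (Hilbert_Choice.inv p i)) = (\<Otimes>i\<in>{..k}. A (p i) i)"
      by (simp add: permutes_inverses[OF p])
    moreover have "evenperm (Hilbert_Choice.inv p) = evenperm p"
      using p by (intro evenperm_inv) (auto simp: permutation_permutes)
    ultimately show "?f (Hilbert_Choice.inv p) = sgn_of p \<otimes> (\<Otimes>i\<in>{..k}. A (p i) i)"
      by simp
  qed
  finally show ?thesis by simp
qed

lemma determinant_one:
  "determinant R k (\<lambda>i j. if i = j then \<one> else \<zero>) = \<one>"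
proof -
  let ?f = "\<lambda>p. sgn_of p \<otimes> (\<Otimes>i\<in>{..k}. if i = p i then \<one> else \<zero>)"
  have zero: "?f p = \<zero>" if "p permutes {..k}" "p \<noteq> id" for p
  proof -
    obtain j where j: "p j \<noteq> j" using \<open>p \<noteq> id\<close> by (auto simp: fun_eq_iff)
    then have "j \<le> k" using \<open>p permutes {..k}\<close> by (meson atMost_iff permutes_not_in)
    then have "{..k} = insert j ({..k} - {j})" by auto
    then have "(\<Otimes>i\<in>{..k}. if i = p i then \<one> else \<zero>) =
        (\<Otimes>i\<in>insert j ({..k} - {j}). if i = p i then \<one> else \<zero>)" by simp
    also have "\<dots> = (if j = p j then \<one> else \<zero>) \<otimes> (\<Otimes>i\<in>{..k} - {j}. if i = p i then \<one> else \<zero>)"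
      by (rule finprod_insert) auto
    also have "\<dots> = \<zero>" using j by (auto simp: l_null finprod_closed)
    finally show ?thesis by simp
  qed
  have "finsum R ?f {p. p permutes {..k}} = finsum R ?f {id}"
  proof (rule add.finprod_mono_neutral_cong_right)
    show "?f p = \<zero>\<^bsub>R\<^esub>" if "p \<in> {p. p permutes {..k}} - {id}" for p
      using zero[of p] that by simp
  qed (auto simp: permutes_id finite_permutations)
  then show ?thesis
    unfolding determinant_def by (simp del: id_apply add: id_def)
qed

lemma determinant_row_linear:
  assumes A: "\<And>i j. i \<le> k \<Longrightarrow> j \<le> k \<Longrightarrow> A i j \<in> carrier R"
    and x: "\<And>j. j \<le> k \<Longrightarrow> x j \<in> carrier R" and y: "\<And>j. j \<le> k \<Longrightarrow> y j \<in> carrier R"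
    and c: "c \<in> carrier R" and r: "r \<le> k"
  shows "determinant R k (A(r := \<lambda>j. x j \<oplus> c \<otimes> y j)) =
    determinant R k (A(r := x)) \<oplus> c \<otimes> determinant R k (A(r := y))"
proof -
  let ?P = "{p. p permutes {..k}}"
  let ?g = "\<lambda>p. \<Otimes>i\<in>{..k} - {r}. A i (p i)"
  have le: "p i \<le> k" if "p permutes {..k}" "i \<le> k" for p i
    using permutes_in_image[OF that(1), of i] that(2) by simp
  have split: "(\<Otimes>i\<in>{..k}. (A(r := z)) i (p i)) = z (p r) \<otimes> ?g p"
    if p: "p permutes {..k}" and z: "\<And>j. j \<le> k \<Longrightarrow> z j \<in> carrier R" for p z
  proof -
    have "{..k} = insert r ({..k} - {r})" using r by auto
    then have "(\<Otimes>i\<in>{..k}. (A(r := z)) i (p i)) =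
        (\<Otimes>i\<in>insert r ({..k} - {r}). (A(r := z)) i (p i))" by simp
    also have "\<dots> = (A(r := z)) r (p r) \<otimes> (\<Otimes>i\<in>{..k} - {r}. (A(r := z)) i (p i))"
      by (rule finprod_insert) (auto simp: A z le[OF p] r)
    also have "(\<Otimes>i\<in>{..k} - {r}. (A(r := z)) i (p i)) = ?g p"
      by (rule finprod_cong') (auto intro!: A le[OF p])
    finally show ?thesis by simp
  qed
  have gc: "?g p \<in> carrier R" if "p permutes {..k}" for p
    by (auto intro!: finprod_closed A le[OF that])
  have det: "determinant R k (A(r := z)) = (\<Oplus>p\<in>?P. sgn_of p \<otimes> (z (p r) \<otimes> ?g p))"
    if z: "\<And>j. j \<le> k \<Longrightarrow> z j \<in> carrier R" for z
    unfolding determinant_def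
    by (rule finsum_cong') (auto simp: split[OF _ z] gc z le[OF _ r] simp del: fun_upd_apply)
  have "determinant R k (A(r := \<lambda>j. x j \<oplus> c \<otimes> y j)) =
      (\<Oplus>p\<in>?P. sgn_of p \<otimes> ((x (p r) \<oplus> c \<otimes> y (p r)) \<otimes> ?g p))"
    by (rule det) (simp add: x y c)
  also have "\<dots> = (\<Oplus>p\<in>?P. sgn_of p \<otimes> (x (p r) \<otimes> ?g p) \<oplus> c \<otimes> (sgn_of p \<otimes> (y (p r) \<otimes> ?g p)))"
  proof (rule finsum_cong'[OF refl])
    show "(\<lambda>p. sgn_of p \<otimes> (x (p r) \<otimes> ?g p) \<oplus> c \<otimes> (sgn_of p \<otimes> (y (p r) \<otimes> ?g p))) \<in> ?P \<rightarrow> carrier R"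
      by (auto simp: gc x y c le[OF _ r])
    fix p assume "p \<in> ?P"
    then have "x (p r) \<in> carrier R" "y (p r) \<in> carrier R" "?g p \<in> carrier R" "sgn_of p \<in> carrier R"
      by (auto simp: gc x y le[OF _ r])
    then show "sgn_of p \<otimes> ((x (p r) \<oplus> c \<otimes> y (p r)) \<otimes> ?g p) =
        sgn_of p \<otimes> (x (p r) \<otimes> ?g p) \<oplus> c \<otimes> (sgn_of p \<otimes> (y (p r) \<otimes> ?g p))"
      using c by (simp only: l_distr r_distr m_closed m_ac)
  qed
  also have "\<dots> = (\<Oplus>p\<in>?P. sgn_of p \<otimes> (x (p r) \<otimes> ?g p)) \<oplus>
      c \<otimes> (\<Oplus>p\<in>?P. sgn_of p \<otimes> (y (p r) \<otimes> ?g p))"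
    by (subst finsum_rdistr)
      (auto intro!: finsum_addf simp: finite_permutations gc x y c le[OF _ r])
  finally show ?thesis by (simp only: det[OF x] det[OF y])
qed

text \<open>
  Composition with the transposition of the two rows is a bijection from the even to the odd
  permutations, and it negates every term. Pairing the terms in this way, instead of deducing
  \<open>d = - d\<close>, remains valid when \<open>2\<close> is a zero divisor.
\<close>
lemma determinant_equal_rows:
  assumes A: "\<And>i j. i \<le> k \<Longrightarrow> j \<le> k \<Longrightarrow> A i j \<in> carrier R"
    and rs: "r \<le> k" "s \<le> k" "r \<noteq> s" and eq: "A r = A s"
  shows "determinant R k A = \<zero>"
proof -
  let ?P = "{p. p permutes {..k}}"
  let ?E = "{p. p permutes {..k} \<and> evenperm p}"
  let ?O = "{p. p permutes {..k} \<and> \<not> evenperm p}"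
  let ?t = "transpose r s"
  let ?f = "\<lambda>p. sgn_of p \<otimes> (\<Otimes>i\<in>{..k}. A i (p i))"
  have t: "?t permutes {..k}" using rs by (simp add: permutes_swap_id)
  have le: "p i \<le> k" if "p permutes {..k}" "i \<le> k" for p i
    using permutes_in_image[OF that(1), of i] that(2) by simp
  have prods: "(\<Otimes>i\<in>{..k}. A i (p i)) \<in> carrier R" if "p permutes {..k}" for p
    by (auto intro!: finprod_closed A le[OF that])
  have parity: "evenperm (p \<circ> ?t) \<longleftrightarrow> \<not> evenperm p" if "p permutes {..k}" for p
  proof -
    have "permutation p" using that by (auto simp: permutation_permutes)
    then show ?thesis using rs
      by (simp add: evenperm_comp permutation_swap_id evenperm_swap)
  qed
  have img: "(\<lambda>p. p \<circ> ?t) ` ?E = ?O"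
  proof (intro equalityI subsetI)
    fix q assume "q \<in> ?O"
    then have "q \<circ> ?t \<in> ?E" using parity permutes_compose[OF t] by auto
    moreover have "q = (q \<circ> ?t) \<circ> ?t" by (simp add: o_assoc[symmetric])
    ultimately show "q \<in> (\<lambda>p. p \<circ> ?t) ` ?E" by blast
  qed (use parity permutes_compose[OF t] in auto)
  have neg: "?f (p \<circ> ?t) = \<ominus> ?f p" if p: "p \<in> ?E" for p
  proof -
    have pp: "p permutes {..k}" using p by simp
    have "(\<Otimes>i\<in>{..k}. A i (p i)) = (\<Otimes>i\<in>?t ` {..k}. A i (p i))"
      by (simp add: permutes_image[OF t])
    also have "\<dots> = (\<Otimes>i\<in>{..k}. A (?t i) (p (?t i)))"
      by (rule finprod_reindex)
        (auto simp: permutes_image[OF t] intro!: A le[OF pp] permutes_inj_on[OF t])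
    also have "\<dots> = (\<Otimes>i\<in>{..k}. A i (p (?t i)))"
    proof (rule finprod_cong'[OF refl])
      show "(\<lambda>i. A i (p (?t i))) \<in> {..k} \<rightarrow> carrier R"
        by (auto intro!: A le[OF pp] le[OF t])
    qed (auto simp: transpose_def eq)
    finally show ?thesis
      using p parity[OF pp] prods[OF pp] by (simp add: l_minus)
  qed
  have "determinant R k A = finsum R ?f (?E \<union> ?O)"
    unfolding determinant_def by (rule arg_cong[where f = "finsum R ?f"]) auto
  also have "\<dots> = finsum R ?f ?E \<oplus> finsum R ?f ?O"
    by (rule finsum_Un_disjoint) (auto simp: prods finite_permutations)
  also have "finsum R ?f ?O = finsum R (\<lambda>p. ?f (p \<circ> ?t)) ?E"
    unfolding img[symmetric]
  proof (rule finsum_reindex)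
    show "?f \<in> (\<lambda>p. p \<circ> ?t) ` ?E \<rightarrow> carrier R" unfolding img using prods by auto
    show "inj_on (\<lambda>p. p \<circ> ?t) ?E"
      by (rule inj_onI) (metis comp_assoc comp_id transpose_comp_involutory)
  qed
  also have "\<dots> = finsum R (\<lambda>p. \<ominus> ?f p) ?E"
    by (rule finsum_cong') (use neg prods in auto)
  also have "finsum R ?f ?E \<oplus> finsum R (\<lambda>p. \<ominus> ?f p) ?E = finsum R (\<lambda>p. ?f p \<oplus> \<ominus> ?f p) ?E"
    by (rule finsum_addf[symmetric]) (auto simp: prods)
  also have "\<dots> = finsum R (\<lambda>p. \<zero>) ?E"
    by (rule finsum_cong') (auto simp: r_neg prods)
  finally show ?thesis by simp
qed

text \<open>
  Elementary column operations preserve \<open>SL\<close>. They are the right ones here because they act on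
  every row by the same rule, so that each row can be followed modulo its own ideal.
\<close>
lemma determinant_col_op:
  assumes A: "\<And>i j. i \<le> k \<Longrightarrow> j \<le> k \<Longrightarrow> A i j \<in> carrier R"
    and c: "c \<in> carrier R" and pq: "p \<le> k" "q \<le> k" "p \<noteq> q"
  shows "determinant R k (\<lambda>i. (A i)(q := A i q \<oplus> c \<otimes> A i p)) = determinant R k A"
proof -
  let ?T = "\<lambda>i j. A j i"
  let ?B = "\<lambda>i. (A i)(q := A i q \<oplus> c \<otimes> A i p)"
  have "determinant R k ?B = determinant R k (\<lambda>i j. ?B j i)"
    by (rule determinant_transpose[symmetric]) (use assms in auto)
  also have "\<dots> = determinant R k (?T(q := \<lambda>j. ?T q j \<oplus> c \<otimes> ?T p j))"
    by (rule arg_cong[where f = "determinant R k"]) (auto simp: fun_eq_iff)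
  also have "\<dots> = determinant R k (?T(q := ?T q)) \<oplus> c \<otimes> determinant R k (?T(q := ?T p))"
    by (rule determinant_row_linear) (use assms in auto)
  also have "determinant R k (?T(q := ?T p)) = \<zero>"
    by (rule determinant_equal_rows[of _ _ p q]) (use assms in auto)
  also have "?T(q := ?T q) = ?T" by auto
  also have "determinant R k ?T = determinant R k A"
    by (rule determinant_transpose[OF A])
  finally show ?thesis
    using c determinant_closed[of k A, OF A] by (simp del: fun_upd_apply)
qed

section \<open>Ideals and maximal ideals\<close>

lemma ideal_finsum_le_iff:
  assumes "finite A" and "\<And>i. i \<in> A \<Longrightarrow> ideal (J i) R" and L: "ideal L R"
  shows "ideal (\<Oplus>\<^bsub>ideals_set R\<^esub> i\<in>A. J i) R \<and>
    ((\<Oplus>\<^bsub>ideals_set R\<^esub> i\<in>A. J i) \<subseteq> L \<longleftrightarrow> (\<forall>i\<in>A. J i \<subseteq> L))"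
  using assms(1,2)
proof (induction A)
  case empty
  interpret S: semiring "ideals_set R" by (rule ideals_set_is_semiring)
  have "\<zero>\<^bsub>ideals_set R\<^esub> = {\<zero>}" by (simp add: ideals_set_def)
  moreover have "\<zero> \<in> L" by (rule additive_subgroup.zero_closed[OF ideal.axioms(1)[OF L]])
  ultimately show ?case by (simp add: zeroideal)
next
  case (insert x F)
  interpret S: semiring "ideals_set R" by (rule ideals_set_is_semiring)
  let ?S = "\<Oplus>\<^bsub>ideals_set R\<^esub> i\<in>F. J i"
  have "(\<Oplus>\<^bsub>ideals_set R\<^esub> i\<in>insert x F. J i) = J x \<oplus>\<^bsub>ideals_set R\<^esub> ?S"
    using insert by (intro S.finsum_insert) (auto simp: ideals_set_def)
  then have eq: "(\<Oplus>\<^bsub>ideals_set R\<^esub> i\<in>insert x F. J i) = J x <+> ?S"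
    by (simp add: ideals_set_def)
  have id: "ideal (J x) R" "ideal ?S R" using insert by auto
  have "J x <+> ?S = Idl (J x \<union> ?S)" by (rule union_genideal[OF id, symmetric])
  then have "J x <+> ?S \<subseteq> L \<longleftrightarrow> J x \<union> ?S \<subseteq> L"
    using genideal_minimal[OF L, of "J x \<union> ?S"] genideal_self[of "J x \<union> ?S"]
      ideal.Icarr[OF id(1)] ideal.Icarr[OF id(2)] by blast
  with eq add_ideals[OF id] insert show ?case by auto
qed

text \<open>
  The sum of the principal ideals is the least ideal containing the entries, so unimodularity can be
  tested against arbitrary ideals, in particular against maximal ones.
\<close>
lemma GCD_tuples_iff:
  "a \<in> GCD_tuples R k \<longleftrightarrow>
    a \<in> tuples R k \<and> (\<forall>L. ideal L R \<longrightarrow> (\<forall>i\<le>k. a i \<in> L) \<longrightarrow> L = carrier R)"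
proof (cases "a \<in> tuples R k")
  case True
  let ?S = "\<Oplus>\<^bsub>ideals_set R\<^esub> i\<in>{..k}. PIdl (a i)"
  have a: "a i \<in> carrier R" if "i \<le> k" for i
    using True that by (auto simp: tuples_def)
  have S: "ideal ?S R" and le: "?S \<subseteq> L \<longleftrightarrow> (\<forall>i\<in>{..k}. PIdl (a i) \<subseteq> L)" if "ideal L R" for L
    using ideal_finsum_le_iff[OF _ _ that, of "{..k}" "\<lambda>i. PIdl (a i)"] a
    by (auto simp: cgenideal_ideal)
  have P: "PIdl (a i) \<subseteq> L \<longleftrightarrow> a i \<in> L" if "ideal L R" "i \<le> k" for L i
    using cgenideal_minimal[OF that(1)] cgenideal_self[OF a[OF that(2)]] by blast
  have "?S = carrier R \<longleftrightarrow> (\<forall>L. ideal L R \<longrightarrow> ?S \<subseteq> L \<longrightarrow> L = carrier R)"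
    using S[OF oneideal] additive_subgroup.a_subset[OF ideal.axioms(1)] by blast
  then show ?thesis using True by (simp add: GCD_tuples_def le P Ball_def)
qed (simp add: GCD_tuples_def)

text \<open>
  Krull's theorem. Zorn's lemma is applied to the ideals avoiding \<open>\<one>\<close> because this property,
  unlike properness, visibly passes to unions of chains.
\<close>
lemma exists_maximalideal:
  assumes I: "ideal I R" and ne: "I \<noteq> carrier R"
  obtains M where "maximalideal M R" "I \<subseteq> M"
proof -
  define A where "A = {J. ideal J R \<and> I \<subseteq> J \<and> \<one> \<notin> J}"
  have "\<exists>M\<in>A. \<forall>N\<in>A. M \<subseteq> N \<longrightarrow> N = M"
  proof (rule subset_Zorn_nonempty)
    have "I \<in> A" using I ne ideal.one_imp_carrier unfolding A_def by blast
    then show "A \<noteq> {}" by blast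
    fix C assume C: "C \<noteq> {}" "subset.chain A C"
    then have "subset.chain {J. ideal J R} C"
      unfolding A_def pred_on.chain_def by blast
    from chain_Union_is_ideal[OF this] C(1) have "ideal (\<Union>C) R" by simp
    moreover have "C \<subseteq> A" using C(2) by (simp add: pred_on.chain_def)
    ultimately show "\<Union>C \<in> A" using C(1) unfolding A_def by auto
  qed
  then obtain M where MA: "M \<in> A" and maxA: "\<forall>N\<in>A. M \<subseteq> N \<longrightarrow> N = M" by (rule bexE)
  have M: "ideal M R" "I \<subseteq> M" "\<one> \<notin> M" using MA by (simp_all add: A_def)
  have max: "N = M" if "ideal N R" "\<one> \<notin> N" "M \<subseteq> N" for N
    using maxA that M(2) by (simp add: A_def)
  have "maximalideal M R"
  proof (rule maximalidealI[OF M(1)])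
    show "carrier R \<noteq> M" using M(3) by auto
    fix J assume "ideal J R" "M \<subseteq> J"
    then show "J = M \<or> J = carrier R"
      using max[of J] ideal.one_imp_carrier[of J R] by blast
  qed
  then show thesis using M(2) that by blast
qed

lemma inverse_mod_ideal:
  assumes J: "ideal J R" and u: "u \<in> carrier R"
    and avoid: "\<And>M. maximalideal M R \<Longrightarrow> J \<subseteq> M \<Longrightarrow> u \<notin> M"
  obtains w where "w \<in> carrier R" "J +> u \<otimes> w = J +> \<one>"
proof -
  interpret J: ideal J R by (rule J)
  have Ju: "ideal (J <+> PIdl u) R" by (rule add_ideals[OF J cgenideal_ideal[OF u]])
  have "J \<union> PIdl u \<subseteq> J <+> PIdl u"
    using genideal_self[of "J \<union> PIdl u"] union_genideal[OF J cgenideal_ideal[OF u]]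
      J.Icarr ideal.Icarr[OF cgenideal_ideal[OF u]] by blast
  then have "J \<subseteq> J <+> PIdl u" "u \<in> J <+> PIdl u" using cgenideal_self[OF u] by auto
  then have "J <+> PIdl u = carrier R"
    using exists_maximalideal[OF Ju] avoid by (metis subset_trans subsetD)
  then have "\<one> \<in> J <+> PIdl u" by simp
  then obtain j x where j: "j \<in> J" and x: "x \<in> PIdl u" and jx: "\<one> = j \<oplus> x"
    unfolding set_add_def' by blast
  from x obtain w where w: "w \<in> carrier R" "x = w \<otimes> u" unfolding cgenideal_def by blast
  have "\<one> \<ominus> u \<otimes> w = j"
    unfolding jx using w u J.Icarr[OF j] by (simp add: m_comm minus_eq a_assoc r_neg)
  then have "J +> \<one> = J +> u \<otimes> w"
    using j w u quotient_eq_iff_same_a_r_cos[OF J, of \<one> "u \<otimes> w"] by simp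
  with w that show thesis by metis
qed

text \<open>
  The idempotent-like elements of the Chinese remainder theorem. Splitting \<open>\<one> = a \<oplus> b\<close> with \<open>a\<close> in
  \<open>J\<close> and \<open>b\<close> in \<open>K t\<close>, the product of the elements \<open>b\<close> over all \<open>t\<close> has both properties.
\<close>
lemma exists_indicator_mod_ideals:
  assumes "finite T" and J: "ideal J R"
    and "\<And>t. t \<in> T \<Longrightarrow> ideal (K t) R" and "\<And>t. t \<in> T \<Longrightarrow> J <+> K t = carrier R"
  obtains e where "e \<in> carrier R" "J +> e = J +> \<one>" "\<And>t. t \<in> T \<Longrightarrow> e \<in> K t"
proof -
  interpret h: ring_hom_ring R "R Quot J" "(+>) J" by (rule ideal.rcos_ring_hom_ring[OF J])
  have "\<exists>e\<in>carrier R. J +> e = J +> \<one> \<and> (\<forall>t\<in>T. e \<in> K t)"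
    using assms(1,3,4)
  proof (induction T)
    case (insert x F)
    then obtain e where e: "e \<in> carrier R" "J +> e = J +> \<one>" "\<forall>t\<in>F. e \<in> K t" by auto
    have "\<one> \<in> J <+> K x" using insert.prems by simp
    then obtain a b where a: "a \<in> J" and b: "b \<in> K x" and ab: "\<one> = a \<oplus> b"
      unfolding set_add_def' by blast
    have ac: "a \<in> carrier R" by (rule ideal.Icarr[OF J a])
    have bc: "b \<in> carrier R" using insert.prems(1) b by (meson ideal.Icarr insertI1)
    have "\<one> \<ominus> b = a" unfolding ab using ac bc by (simp add: minus_eq a_assoc r_neg)
    then have "J +> \<one> = J +> b"
      using a bc quotient_eq_iff_same_a_r_cos[OF J, of \<one> b] by simp
    then have "J +> (e \<otimes> b) = J +> \<one>"
      using e bc by (simp add: h.hom_mult) (metis h.hom_mult h.hom_one one_closed r_one)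
    moreover have "e \<otimes> b \<in> K t" if "t \<in> insert x F" for t
      using that e b bc insert.prems(1)[OF that] by (auto intro: ideal.I_l_closed ideal.I_r_closed)
    ultimately show ?case using e bc by (intro bexI[of _ "e \<otimes> b"]) auto
  qed (auto intro: bexI[of _ \<one>])
  then show thesis using that by blast
qed

lemma maximalideals_comaximal:
  assumes M: "maximalideal M R" and N: "maximalideal N R" and ne: "M \<noteq> N"
  shows "M <+> N = carrier R"
proof -
  interpret M: maximalideal M R by (rule M)
  interpret N: maximalideal N R by (rule N)
  have MN: "ideal (M <+> N) R" by (rule add_ideals[OF M.is_ideal N.is_ideal])
  have sub: "M \<subseteq> M <+> N" "N \<subseteq> M <+> N"
    using genideal_self[of "M \<union> N"] union_genideal[OF M.is_ideal N.is_ideal]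
      M.Icarr N.Icarr by blast+
  have "M <+> N \<subseteq> carrier R" using ideal.Icarr[OF MN] by blast
  then show ?thesis
    using M.I_maximal[OF MN sub(1)] N.I_maximal[OF MN sub(2)] ne by auto
qed

text \<open>
  The source of the finiteness hypothesis: this is the stable range condition of a semilocal ring.
  When a new maximal ideal \<open>M\<close> is violated by the current \<open>c\<close>, then \<open>b\<close> is not in \<open>M\<close>, and adding
  to \<open>c\<close> an element that is \<open>\<one>\<close> modulo \<open>M\<close> and lies in the earlier maximal ideals repairs \<open>M\<close>
  without disturbing them.
\<close>
lemma avoid_maximalideals:
  assumes "finite \<M>" and "\<And>M. M \<in> \<M> \<Longrightarrow> maximalideal M R"
    and a: "a \<in> carrier R" and b: "b \<in> carrier R"
  obtains c where "c \<in> carrier R"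
    "\<And>M. M \<in> \<M> \<Longrightarrow> a \<notin> M \<or> b \<notin> M \<Longrightarrow> a \<oplus> c \<otimes> b \<notin> M"
proof -
  have "\<exists>c\<in>carrier R. \<forall>M\<in>\<M>. a \<notin> M \<or> b \<notin> M \<longrightarrow> a \<oplus> c \<otimes> b \<notin> M"
    using assms(1,2)
  proof (induction \<M>)
    case empty
    then show ?case by (auto intro: bexI[of _ \<zero>])
  next
    case (insert M F)
    then obtain c where c: "c \<in> carrier R" "\<forall>N\<in>F. a \<notin> N \<or> b \<notin> N \<longrightarrow> a \<oplus> c \<otimes> b \<notin> N"
      by auto
    interpret M: maximalideal M R using insert.prems by simp
    have M_add: "y \<in> M" if "x \<in> M" "x \<oplus> y \<in> M" "y \<in> carrier R" for x y
    proof -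
      have "y = (x \<oplus> y) \<ominus> x"
        using that M.Icarr[OF that(1)] by (simp add: minus_eq a_comm a_assoc r_neg r_neg1)
      then show ?thesis using that by (metis M.a_closed M.a_inv_closed minus_eq)
    qed
    show ?case
    proof (cases "b \<in> M \<or> a \<oplus> c \<otimes> b \<notin> M")
      case True
      have "a \<oplus> c \<otimes> b \<notin> M" if "b \<in> M" "a \<notin> M"
        using M_add[of "c \<otimes> b" a] that a b c by (metis M.I_l_closed a_comm m_closed)
      with True c show ?thesis by (intro bexI[of _ c]) auto
    next
      case False
      have "ideal N R" "M <+> N = carrier R" if "N \<in> F" for N
        using maximalideals_comaximal[OF M.is_maximalideal, of N] insert.prems[of N] insert.hyps that
        by (auto dest: maximalideal.axioms(1))
      then obtain e where e: "e \<in> carrier R" "M +> e = M +> \<one>" "\<And>N. N \<in> F \<Longrightarrow> e \<in> N"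
        using exists_indicator_mod_ideals[OF insert.hyps(1) M.is_ideal, of "\<lambda>N. N"] by blast
      have expand: "a \<oplus> (c \<oplus> e) \<otimes> b = (a \<oplus> c \<otimes> b) \<oplus> e \<otimes> b"
        using a b c e by (simp add: l_distr a_assoc)
      have "a \<oplus> (c \<oplus> e) \<otimes> b \<notin> M"
      proof
        assume "a \<oplus> (c \<oplus> e) \<otimes> b \<in> M"
        with False have "e \<otimes> b \<in> M"
          unfolding expand using M_add a b c e by (metis a_closed m_closed)
        moreover have "primeideal M R" by (rule maximalideal_prime[OF M.is_maximalideal])
        ultimately have "e \<in> M" using False primeideal.I_prime[of M R e b] e b by blast
        then have "M +> \<one> = M" using e(2) a_rcos_zero[OF M.is_ideal] by simp
        then have "\<one> \<in> M" using M.rcos_const_imp_mem by simp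
        then show False using M.one_imp_carrier M.I_notcarr by simp
      qed
      moreover have "a \<oplus> (c \<oplus> e) \<otimes> b \<notin> N" if N: "N \<in> F" and ab: "a \<notin> N \<or> b \<notin> N" for N
      proof
        interpret N: maximalideal N R using insert.prems N by simp
        assume "a \<oplus> (c \<oplus> e) \<otimes> b \<in> N"
        moreover have "e \<otimes> b \<in> N" using e N b by (simp add: N.I_r_closed)
        ultimately have "(a \<oplus> c \<otimes> b) \<oplus> e \<otimes> b \<oplus> \<ominus> (e \<otimes> b) \<in> N"
          unfolding expand by (metis N.a_closed N.a_inv_closed)
        then have "a \<oplus> c \<otimes> b \<in> N" using a b c e by (simp add: a_assoc r_neg)
        then show False using c N ab by blast
      qed
      ultimately show ?thesis using c e by (intro bexI[of _ "c \<oplus> e"]) auto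
    qed
  qed
  then show thesis using that by blast
qed

lemma primeideal_over_ideal_finprod:
  assumes "finite A" and "\<And>i. i \<in> A \<Longrightarrow> ideal (Q i) R" and P: "primeideal P R"
  shows "ideal (\<Otimes>\<^bsub>ideals_set R\<^esub> i\<in>A. Q i) R \<and>
    ((\<Otimes>\<^bsub>ideals_set R\<^esub> i\<in>A. Q i) \<subseteq> P \<longrightarrow> (\<exists>i\<in>A. Q i \<subseteq> P))"
  using assms(1,2)
proof (induction A)
  case empty
  interpret S: comm_monoid "ideals_set R" by (rule ideals_set_is_comm_monoid)
  have "\<one>\<^bsub>ideals_set R\<^esub> = carrier R" by (simp add: ideals_set_def)
  moreover have "\<not> carrier R \<subseteq> P"
    using P primeideal.I_notcarr[OF P] ideal.Icarr[OF primeideal.axioms(1)[OF P]] by blast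
  ultimately show ?case by (simp add: oneideal)
next
  case (insert x F)
  interpret S: comm_monoid "ideals_set R" by (rule ideals_set_is_comm_monoid)
  let ?S = "\<Otimes>\<^bsub>ideals_set R\<^esub> i\<in>F. Q i"
  have "(\<Otimes>\<^bsub>ideals_set R\<^esub> i\<in>insert x F. Q i) = Q x \<otimes>\<^bsub>ideals_set R\<^esub> ?S"
    using insert by (intro S.finprod_insert) (auto simp: ideals_set_def)
  then have eq: "(\<Otimes>\<^bsub>ideals_set R\<^esub> i\<in>insert x F. Q i) = Q x \<cdot> ?S"
    by (simp add: ideals_set_def)
  have id: "ideal (Q x) R" "ideal ?S R" using insert by auto
  show ?case
    using ideal_prod_is_ideal[OF id] primeideal_divides_ideal_prod[OF P id] insert
    unfolding eq by auto
qed

text \<open>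
  A maximal ideal over a product of ideals \<open>Q i j\<close> is prime, hence contains some \<open>Q i j\<close>, hence
  its radical \<open>M i j\<close>; so it is one of these finitely many maximal ideals.
\<close>
lemma primary_type_products_finitely_many_maximal:
  assumes "primary_type_products R k I" and i: "i \<le> k"
  shows "finitely_many_maximal_over R (I i)"
proof (cases "I i = carrier R")
  case True
  have "\<not> carrier R \<subseteq> N" if "maximalideal N R" for N
    using maximalideal.I_notcarr[OF that] ideal.Icarr[OF maximalideal.axioms(1)[OF that]] by blast
  then have "{N. maximalideal N R \<and> I i \<subseteq> N} = {}"
    unfolding True by simp
  then show ?thesis unfolding finitely_many_maximal_over_def by (simp only: finite.emptyI)
next
  case False
  from assms(1) obtain r :: "nat \<Rightarrow> nat" and Q M where
    "\<forall>i\<le>k. I i = carrier R \<or> (1 \<le> r i \<and>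
      (\<forall>j\<in>{1..r i}. ideal (Q i j) R \<and> maximalideal (M i j) R \<and>
        ideal_radical R (Q i j) = M i j) \<and>
      I i = (\<Otimes>\<^bsub>ideals_set R\<^esub> j\<in>{1..r i}. Q i j))"
    unfolding primary_type_products_def by (elim exE conjE) (rule that)
  with i False have data: "\<forall>j\<in>{1..r i}. ideal (Q i j) R \<and> maximalideal (M i j) R \<and>
      ideal_radical R (Q i j) = M i j"
    and I_eq: "I i = (\<Otimes>\<^bsub>ideals_set R\<^esub> j\<in>{1..r i}. Q i j)"
    by auto
  have Q: "ideal (Q i j) R" and M: "maximalideal (M i j) R"
    and rad: "ideal_radical R (Q i j) = M i j" if "j \<in> {1..r i}" for j
    using data that by auto
  have "N \<in> M i ` {1..r i}" if N: "maximalideal N R" and sub: "I i \<subseteq> N" for N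
  proof -
    have P: "primeideal N R" by (rule maximalideal_prime[OF N])
    obtain j where j: "j \<in> {1..r i}" "Q i j \<subseteq> N"
      using sub I_eq primeideal_over_ideal_finprod[OF _ Q P, of "{1..r i}" "\<lambda>j. j"] by auto
    have pow: "x \<in> N" if "x \<in> carrier R" "x [^] (n::nat) \<in> N" for x n
      using that(2)
    proof (induction n)
      case 0
      then show ?case
        using ideal.one_imp_carrier[OF maximalideal.axioms(1)[OF N]] that(1) by simp
    next
      case (Suc n)
      then show ?case using primeideal.I_prime[OF P, of "x [^] n" x] that(1) by auto
    qed
    have "M i j \<subseteq> N"
      unfolding rad[OF j(1), symmetric] ideal_radical_def using pow j(2) by blast
    then have "N = M i j \<or> N = carrier R"
      using maximalideal.I_maximal[OF M[OF j(1)] maximalideal.axioms(1)[OF N]]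
        ideal.Icarr[OF maximalideal.axioms(1)[OF N]] by blast
    then show ?thesis using maximalideal.I_notcarr[OF N] j by auto
  qed
  then have "{N. maximalideal N R \<and> I i \<subseteq> N} \<subseteq> M i ` {1..r i}" by blast
  then show ?thesis
    unfolding finitely_many_maximal_over_def by (rule finite_subset) simp
qed

section \<open>Lifting unimodular rows to a matrix of determinant one\<close>

text \<open>
  Elementary operations act transitively on the rows that are unimodular modulo \<open>J\<close>, in the form of
  an induction rule: a property of the unit row \<open>e\<^sub>i\<close> that survives elementary operations and changes
  modulo \<open>J\<close> holds for \<open>x\<close>. Elementary operations are invertible, so \<open>x\<close> may be simplified
  backwards: make its entry \<open>i\<close> a unit modulo \<open>J\<close>, use the unit to turn another entry \<open>p\<close> into
  \<open>\<one>\<close>, and use that entry to turn the entry \<open>i\<close> into \<open>\<one>\<close>. Such a row is reached from \<open>e\<^sub>i\<close> by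
  adding multiples of the entry \<open>i\<close> to the others. A second position \<open>p\<close> exists because \<open>k \<ge> 1\<close>.
\<close>
lemma unimodular_elementary_induct:
  fixes k i :: nat and x :: "nat \<Rightarrow> 'a"
  assumes J: "ideal J R" and fin: "finitely_many_maximal_over R J"
    and k: "1 \<le> k" and i: "i \<le> k"
    and x: "\<And>j. j \<le> k \<Longrightarrow> x j \<in> carrier R"
    and unimodular: "\<And>M. maximalideal M R \<Longrightarrow> J \<subseteq> M \<Longrightarrow> \<exists>j\<le>k. x j \<notin> M"
    and base: "P (\<lambda>j. if j = i then \<one> else \<zero>)"
    and step: "\<And>y p q c. P y \<Longrightarrow> (\<And>j. j \<le> k \<Longrightarrow> y j \<in> carrier R) \<Longrightarrow> p \<le> k \<Longrightarrow> q \<le> k \<Longrightarrow> p \<noteq> q \<Longrightarrow>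
      c \<in> carrier R \<Longrightarrow> P (y(q := y q \<oplus> c \<otimes> y p))"
    and cong: "\<And>y z. P y \<Longrightarrow> (\<And>j. j \<le> k \<Longrightarrow> y j \<in> carrier R) \<Longrightarrow> (\<And>j. j \<le> k \<Longrightarrow> z j \<in> carrier R) \<Longrightarrow>
      (\<And>j. j \<le> k \<Longrightarrow> J +> y j = J +> z j) \<Longrightarrow> P z"
  shows "P x"
proof -
  interpret J: ideal J R by (rule J)
  interpret Q: cring "R Quot J" by (rule J.quotient_is_cring[OF is_cring])
  interpret h: ring_hom_ring R "R Quot J" "(+>) J" by (rule J.rcos_ring_hom_ring)
  have step_back: "P y"
    if Py: "P (y(q := y q \<oplus> c \<otimes> y p))" and y: "\<And>j. j \<le> k \<Longrightarrow> y j \<in> carrier R"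
      and pq: "p \<le> k" "q \<le> k" "p \<noteq> q" and c: "c \<in> carrier R" for y p q c
  proof -
    let ?y = "y(q := y q \<oplus> c \<otimes> y p)"
    have "P (?y(q := ?y q \<oplus> (\<ominus> c) \<otimes> ?y p))"
      using y c pq by (intro step[OF Py]) auto
    moreover have "?y(q := ?y q \<oplus> (\<ominus> c) \<otimes> ?y p) = y"
      using y c pq by (auto simp: fun_eq_iff a_assoc l_minus r_neg)
    ultimately show ?thesis by simp
  qed
  let ?MM = "{M. maximalideal M R \<and> J \<subseteq> M}"
  \<comment> \<open>Each maximal ideal over \<open>J\<close> misses some \<open>x j\<close>; adding the other entries to the entry \<open>i\<close> one at a
    time brings the entry \<open>i\<close> out of every maximal ideal missed by an entry treated so far.\<close>
  have finMM: "finite ?MM" using fin by (simp only: finitely_many_maximal_over_def)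
  have "\<exists>y. (P y \<longrightarrow> P x) \<and> (\<forall>j\<le>k. y j \<in> carrier R) \<and> (\<forall>j. j \<noteq> i \<longrightarrow> y j = x j) \<and>
      (\<forall>M\<in>?MM. x i \<notin> M \<or> (\<exists>j\<in>T. x j \<notin> M) \<longrightarrow> y i \<notin> M)"
    if "finite T" "T \<subseteq> {..k} - {i}" for T
    using that
  proof (induction T)
    case empty
    show ?case by (rule exI[of _ x]) (use x in auto)
  next
    case (insert t T)
    then obtain y where y: "P y \<longrightarrow> P x" "\<forall>j\<le>k. y j \<in> carrier R" "\<forall>j. j \<noteq> i \<longrightarrow> y j = x j"
      "\<forall>M\<in>?MM. x i \<notin> M \<or> (\<exists>j\<in>T. x j \<notin> M) \<longrightarrow> y i \<notin> M" by auto
    have t: "t \<le> k" "t \<noteq> i" using insert.prems by auto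
    have yit: "y i \<in> carrier R" "y t \<in> carrier R" using y(2) t i by auto
    obtain c where c: "c \<in> carrier R"
      and c_avoid: "\<And>M. M \<in> ?MM \<Longrightarrow> y i \<notin> M \<or> y t \<notin> M \<Longrightarrow> y i \<oplus> c \<otimes> y t \<notin> M"
      using avoid_maximalideals[OF finMM, of "y i" "y t"] yit by auto
    let ?y = "y(i := y i \<oplus> c \<otimes> y t)"
    have "P y" if "P ?y" by (rule step_back[OF that]) (use y(2) t i c in auto)
    then have reach: "P ?y \<Longrightarrow> P x" using y(1) by blast
    have carr: "?y j \<in> carrier R" if "j \<le> k" for j using y(2) yit c that by auto
    have same: "?y j = x j" if "j \<noteq> i" for j using y(3) that by simp
    have avoid: "?y i \<notin> M" if "M \<in> ?MM" "x i \<notin> M \<or> (\<exists>j\<in>insert t T. x j \<notin> M)" for M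
      using c_avoid[OF that(1)] that y(3,4) t by auto
    show ?case
      by (intro exI[of _ ?y] conjI allI ballI impI reach carr same avoid)
  qed
  from this[OF finite_Diff[OF finite_atMost[of k], of "{i}"] subset_refl] obtain y where y: "P y \<longrightarrow> P x"
    and yc': "\<forall>j\<le>k. y j \<in> carrier R" and "\<forall>j. j \<noteq> i \<longrightarrow> y j = x j"
    and y_avoid: "\<forall>M\<in>?MM. x i \<notin> M \<or> (\<exists>j\<in>{..k} - {i}. x j \<notin> M) \<longrightarrow> y i \<notin> M"
    by (elim exE conjE) (rule that)
  have yc: "y j \<in> carrier R" if "j \<le> k" for j using yc' that by blast
  have "y i \<notin> M" if M: "maximalideal M R" "J \<subseteq> M" for M
  proof -
    obtain j where "j \<le> k" "x j \<notin> M" using unimodular[OF M] by blast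
    then have "x i \<notin> M \<or> (\<exists>j\<in>{..k} - {i}. x j \<notin> M)" by (cases "j = i") auto
    with y_avoid M show ?thesis by blast
  qed
  then obtain w where w: "w \<in> carrier R" "J +> y i \<otimes> w = J +> \<one>"
    using inverse_mod_ideal[OF J yc[OF i]] by blast
  obtain p where p: "p \<le> k" "p \<noteq> i"
  proof (cases "i = 0")
    case True then show ?thesis using k that[of 1] by simp
  next
    case False then show ?thesis using that[of 0] by simp
  qed
  \<comment> \<open>As \<open>w\<close> inverts \<open>y i\<close> modulo \<open>J\<close>, this adds \<open>\<one> \<ominus> y p\<close> to \<open>y p\<close> modulo \<open>J\<close>.\<close>
  define y1 where "y1 = y(p := y p \<oplus> (w \<otimes> (\<one> \<ominus> y p)) \<otimes> y i)"
  have y1: "P y1 \<Longrightarrow> P y"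
    unfolding y1_def
    by (rule step_back[of y p "w \<otimes> (\<one> \<ominus> y p)" i]) (use yc p i w in auto)
  have y1c: "y1 j \<in> carrier R" if "j \<le> k" for j
    using yc p i w that by (auto simp: y1_def)
  have y1p: "J +> y1 p = J +> \<one>"
  proof -
    have "y1 p = y p \<oplus> (y i \<otimes> w) \<otimes> (\<one> \<ominus> y p)"
      using yc[OF i] yc[OF p(1)] w by (simp add: y1_def m_ac)
    also have "J +> \<dots> = (J +> y p) \<oplus>\<^bsub>R Quot J\<^esub> (J +> \<one>) \<otimes>\<^bsub>R Quot J\<^esub> (J +> (\<one> \<ominus> y p))"
      using yc[OF i] yc[OF p(1)] w by (simp add: h.hom_add h.hom_mult del: h.hom_one)
    also have "\<dots> = J +> (y p \<oplus> \<one> \<otimes> (\<one> \<ominus> y p))"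
      using yc[OF p(1)] by (simp add: h.hom_add h.hom_mult)
    also have "y p \<oplus> \<one> \<otimes> (\<one> \<ominus> y p) = \<one>"
      using yc[OF p(1)] by (simp add: minus_eq a_lcomm r_neg)
    finally show ?thesis .
  qed
  define y2 where "y2 = y1(i := y1 i \<oplus> (\<one> \<ominus> y1 i) \<otimes> y1 p)"
  have y2: "P y2 \<Longrightarrow> P y1"
    unfolding y2_def
    by (rule step_back[of y1 i "\<one> \<ominus> y1 i" p]) (use y1c p i in auto)
  have y2c: "y2 j \<in> carrier R" if "j \<le> k" for j
    using y1c p i that by (auto simp: y2_def)
  have y2i: "J +> y2 i = J +> \<one>"
  proof -
    have "J +> y2 i = (J +> y1 i) \<oplus>\<^bsub>R Quot J\<^esub> (J +> (\<one> \<ominus> y1 i)) \<otimes>\<^bsub>R Quot J\<^esub> (J +> y1 p)"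
      using y1c[OF i] y1c[OF p(1)] by (simp add: y2_def h.hom_add h.hom_mult)
    also have "\<dots> = J +> (y1 i \<oplus> (\<one> \<ominus> y1 i) \<otimes> \<one>)"
      unfolding y1p using y1c[OF i] by (simp add: h.hom_add h.hom_mult)
    also have "y1 i \<oplus> (\<one> \<ominus> y1 i) \<otimes> \<one> = \<one>"
      using y1c[OF i] by (simp add: minus_eq a_lcomm r_neg)
    finally show ?thesis .
  qed
  have "P (\<lambda>j. if j = i then \<one> else if j \<in> T then y2 j else \<zero>)"
    if "finite T" "T \<subseteq> {..k} - {i}" for T
    using that
  proof (induction T)
    case empty
    show ?case using base by (simp cong: if_cong)
  next
    case (insert t T)
    let ?z = "\<lambda>j. if j = i then \<one> else if j \<in> T then y2 j else \<zero>"
    have t: "t \<le> k" "t \<noteq> i" using insert.prems by auto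
    have "P (?z(t := ?z t \<oplus> y2 t \<otimes> ?z i))"
      using insert.prems insert.IH t i y2c by (intro step) auto
    also have "?z(t := ?z t \<oplus> y2 t \<otimes> ?z i) = (\<lambda>j. if j = i then \<one> else if j \<in> insert t T then y2 j else \<zero>)"
      using insert.hyps t y2c[OF t(1)] by auto
    finally show ?case .
  qed
  from this[of "{..k} - {i}"] have "P (\<lambda>j. if j = i then \<one> else if j \<in> {..k} - {i} then y2 j else \<zero>)"
    by simp
  then have "P y2"
    by (rule cong) (use y2c y2i in auto)
  with y y1 y2 show ?thesis by blast
qed

text \<open>
  Let \<open>S\<close> be the set of matrices congruent, row by row modulo the ideals \<open>I i\<close>, to a matrix of
  determinant one. A column operation with a coefficient lying in all \<open>I l\<close> for \<open>l \<noteq> i\<close> changes row \<open>i\<close>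
  only, as far as these congruences can see. So \<open>S\<close> is closed under elementary operations on a single
  row, and the rows of the identity matrix can be replaced by the rows of \<open>x\<close> one after the other.
\<close>
lemma exists_determinant_one_mod_ideals:
  assumes I: "comaximal_ideals R k I" and fin: "\<And>i. i \<le> k \<Longrightarrow> finitely_many_maximal_over R (I i)"
    and k: "1 \<le> k"
    and x: "\<And>i j. i \<le> k \<Longrightarrow> j \<le> k \<Longrightarrow> x i j \<in> carrier R"
    and unimodular: "\<And>i M. i \<le> k \<Longrightarrow> maximalideal M R \<Longrightarrow> I i \<subseteq> M \<Longrightarrow> \<exists>j\<le>k. x i j \<notin> M"
  shows "\<exists>A. (\<forall>i\<le>k. \<forall>j\<le>k. A i j \<in> carrier R) \<and> determinant R k A = \<one> \<and>
    (\<forall>i\<le>k. \<forall>j\<le>k. I i +> A i j = I i +> x i j)"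
proof -
  define S where "S = {Y. \<exists>A. (\<forall>i\<le>k. \<forall>j\<le>k. A i j \<in> carrier R) \<and> determinant R k A = \<one> \<and>
    (\<forall>i\<le>k. \<forall>j\<le>k. I i +> A i j = I i +> Y i j)}"
  have I_ideal: "ideal (I i) R" if "i \<le> k" for i
    using I that by (simp add: comaximal_ideals_def)
  have step: "Y(i := (Y i)(q := Y i q \<oplus> c \<otimes> Y i p)) \<in> S"
    if Y: "Y \<in> S" and Yc: "\<And>j. j \<le> k \<Longrightarrow> Y i j \<in> carrier R" and i: "i \<le> k"
      and pq: "p \<le> k" "q \<le> k" "p \<noteq> q" and c: "c \<in> carrier R" for Y i p q c
  proof -
    from Y obtain A where A: "\<And>i j. i \<le> k \<Longrightarrow> j \<le> k \<Longrightarrow> A i j \<in> carrier R"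
      and det: "determinant R k A = \<one>"
      and AY: "\<And>i j. i \<le> k \<Longrightarrow> j \<le> k \<Longrightarrow> I i +> A i j = I i +> Y i j"
      unfolding S_def by blast
    obtain e where e: "e \<in> carrier R" "I i +> e = I i +> \<one>" "\<And>l. l \<in> {..k} - {i} \<Longrightarrow> e \<in> I l"
      using exists_indicator_mod_ideals[of "{..k} - {i}" "I i" I] I i
      unfolding comaximal_ideals_def by auto
    \<comment> \<open>The factor \<open>e\<close> is \<open>\<one>\<close> modulo \<open>I i\<close> and hides the operation from all other rows.\<close>
    let ?B = "\<lambda>l. (A l)(q := A l q \<oplus> (e \<otimes> c) \<otimes> A l p)"
    have B_det: "determinant R k ?B = \<one>"
      using determinant_col_op[of k A "e \<otimes> c" p q] A e c pq det by simp
    have B_carr: "?B l j \<in> carrier R" if "l \<le> k" "j \<le> k" for l j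
      using A that pq e c by simp
    have B_cong: "I l +> ?B l j = I l +> (Y(i := (Y i)(q := Y i q \<oplus> c \<otimes> Y i p))) l j"
      if l: "l \<le> k" and j: "j \<le> k" for l j
    proof (cases "j = q")
      case False
      then show ?thesis using AY[OF l j] by simp
    next
      case True
      interpret Il: ideal "I l" R by (rule I_ideal[OF l])
      interpret Q: cring "R Quot I l" by (rule Il.quotient_is_cring[OF is_cring])
      interpret h: ring_hom_ring R "R Quot I l" "(+>) (I l)" by (rule Il.rcos_ring_hom_ring)
      have Alc: "A l q \<in> carrier R" "A l p \<in> carrier R" using A l pq by auto
      have "I l +> ?B l j = (I l +> A l q) \<oplus>\<^bsub>R Quot I l\<^esub>
          ((I l +> e) \<otimes>\<^bsub>R Quot I l\<^esub> (I l +> c)) \<otimes>\<^bsub>R Quot I l\<^esub> (I l +> A l p)"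
        using True Alc e c by (simp add: h.hom_add h.hom_mult)
      also have "\<dots> = I l +> (Y(i := (Y i)(q := Y i q \<oplus> c \<otimes> Y i p))) l j"
      proof (cases "l = i")
        case li: True
        have "I l +> e = I l +> \<one>" using e(2) li by simp
        moreover have "Y l p \<in> carrier R" "Y l q \<in> carrier R" using Yc pq li by auto
        moreover have "(Y(i := (Y i)(q := Y i q \<oplus> c \<otimes> Y i p))) l j = Y l q \<oplus> c \<otimes> Y l p"
          using li True by simp
        ultimately show ?thesis
          using c by (simp add: AY[OF l pq(1)] AY[OF l pq(2)] h.hom_add h.hom_mult)
      next
        case False
        then have "e \<in> I l" using e(3) l by simp
        from a_rcos_zero[OF Il.is_ideal this] have "I l +> e = \<zero>\<^bsub>R Quot I l\<^esub>"
          unfolding FactRing_def ring.simps .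
        then show ?thesis
          using True False Alc c AY[OF l pq(2), symmetric] by simp
      qed
      finally show ?thesis .
    qed
    show ?thesis
      unfolding S_def mem_Collect_eq
      by (intro exI[of _ ?B] conjI allI impI B_det B_carr B_cong)
  qed
  have cong: "Y(i := z) \<in> S" if "Y(i := y) \<in> S" "\<And>j. j \<le> k \<Longrightarrow> I i +> y j = I i +> z j" for Y i y z
  proof -
    from that(1) obtain A where "\<forall>i\<le>k. \<forall>j\<le>k. A i j \<in> carrier R" "determinant R k A = \<one>"
      and AY: "\<forall>l\<le>k. \<forall>j\<le>k. I l +> A l j = I l +> (Y(i := y)) l j"
      unfolding S_def by blast
    moreover have "\<forall>l\<le>k. \<forall>j\<le>k. I l +> A l j = I l +> (Y(i := z)) l j"
      using AY that(2) by auto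
    ultimately show ?thesis unfolding S_def by blast
  qed
  let ?E = "\<lambda>i j. if j = i then \<one> else \<zero>"
  have "(\<lambda>i. if i < n then x i else ?E i) \<in> S" if "n \<le> Suc k" for n
    using that
  proof (induction n)
    case 0
    have "determinant R k ?E = \<one>"
      using determinant_one[of k] by (simp add: eq_commute)
    then have "?E \<in> S" unfolding S_def by (intro CollectI exI[of _ ?E]) auto
    then show ?case by simp
  next
    case (Suc n)
    let ?Y = "\<lambda>i. if i < n then x i else ?E i"
    have n: "n \<le> k" using Suc.prems by simp
    have "?Y(n := x n) \<in> S"
    proof (rule unimodular_elementary_induct[where P = "\<lambda>y. ?Y(n := y) \<in> S",
          OF I_ideal[OF n] fin[OF n] k n x[OF n]])
      show "?Y(n := ?E n) \<in> S" using Suc by (simp add: fun_upd_idem)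
      show "?Y(n := y(q := y q \<oplus> c \<otimes> y p)) \<in> S"
        if "?Y(n := y) \<in> S" "\<And>j. j \<le> k \<Longrightarrow> y j \<in> carrier R" "p \<le> k" "q \<le> k" "p \<noteq> q" "c \<in> carrier R"
        for y p q c
        using step[of "?Y(n := y)" n p q c] that n by simp
    qed (use unimodular[OF n] cong in auto)
    also have "?Y(n := x n) = (\<lambda>i. if i < Suc n then x i else ?E i)"
      by (auto simp: fun_eq_iff less_Suc_eq)
    finally show ?case .
  qed
  from this[of "Suc k"] show ?thesis
    unfolding S_def by (auto simp: less_Suc_eq_le)
qed

text \<open>
  Every term of the determinant has a factor from row \<open>i\<close>, so an ideal containing that row contains
  \<open>\<one>\<close>.
\<close>
lemma SL_row_in_GCD_tuples:
  assumes A: "A \<in> SL R k" and i: "i \<le> k"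
  shows "A i \<in> GCD_tuples R k"
proof -
  have t: "A i \<in> tuples R k" if "i \<le> k" for i using A that by (auto simp: SL_def)
  then have Ac: "A i j \<in> carrier R" if "i \<le> k" "j \<le> k" for i j
    using that by (fastforce simp: tuples_def)
  have "L = carrier R" if L: "ideal L R" and AL: "\<And>j. j \<le> k \<Longrightarrow> A i j \<in> L" for L
  proof -
    interpret L: ideal L R by (rule L)
    have term_in: "sgn_of p \<otimes> (\<Otimes>i\<in>{..k}. A i (p i)) \<in> L" if p: "p permutes {..k}" for p
    proof -
      have le: "p j \<le> k" if "j \<le> k" for j
        using permutes_in_image[OF p, of j] that by simp
      have "{..k} = insert i ({..k} - {i})" using i by auto
      then have "(\<Otimes>i\<in>{..k}. A i (p i)) = (\<Otimes>i\<in>insert i ({..k} - {i}). A i (p i))" by simp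
      also have "\<dots> = A i (p i) \<otimes> (\<Otimes>i\<in>{..k} - {i}. A i (p i))"
        by (rule finprod_insert) (auto simp: Ac le i)
      also have "\<dots> \<in> L"
        by (rule L.I_r_closed[OF AL[OF le[OF i]]]) (auto intro!: finprod_closed simp: Ac le)
      finally show ?thesis by (auto intro!: L.I_l_closed)
    qed
    have "finsum R (\<lambda>p. sgn_of p \<otimes> (\<Otimes>i\<in>{..k}. A i (p i))) T \<in> L"
      if "finite T" "T \<subseteq> {p. p permutes {..k}}" for T
      using that
    proof (induction T)
      case (insert p T)
      note term_in = term_in L.Icarr[OF term_in]
      have "finsum R (\<lambda>p. sgn_of p \<otimes> (\<Otimes>i\<in>{..k}. A i (p i))) (insert p T) =
          sgn_of p \<otimes> (\<Otimes>i\<in>{..k}. A i (p i)) \<oplus> finsum R (\<lambda>p. sgn_of p \<otimes> (\<Otimes>i\<in>{..k}. A i (p i))) T"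
        using insert term_in by (intro finsum_insert) (auto simp del: if_split)
      then show ?case using insert term_in by (auto simp del: if_split)
    qed simp
    then have "determinant R k A \<in> L"
      unfolding determinant_def by (simp add: finite_permutations)
    then show "L = carrier R" using A L.one_imp_carrier by (simp add: SL_def)
  qed
  with t[OF i] show ?thesis by (auto simp: GCD_tuples_iff)
qed

text \<open>
  Rows of matrices of determinant one are unimodular, so the map lands in the product of the
  projective spaces. For surjectivity, representatives of the classes are lifted
  to rows congruent to them modulo the ideals, so the scalar \<open>\<lambda> = \<one>\<close> witnesses every equivalence.
\<close>
lemma row_map_surjective:
  assumes k: "1 \<le> k" and I: "comaximal_ideals R k I"
    and fin: "\<And>i. i \<le> k \<Longrightarrow> finitely_many_maximal_over R (I i)"
  shows "row_map R k m I ` SL R k = (\<Pi>\<^sub>E i\<in>{..k}. PF R k (m i) (I i))"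
proof (intro equalityI subsetI)
  fix f assume "f \<in> row_map R k m I ` SL R k"
  then show "f \<in> (\<Pi>\<^sub>E i\<in>{..k}. PF R k (m i) (I i))"
    by (auto simp: row_map_def PF_def PF_class_def intro!: quotientI SL_row_in_GCD_tuples)
next
  fix f assume f: "f \<in> (\<Pi>\<^sub>E i\<in>{..k}. PF R k (m i) (I i))"
  have I_ideal: "ideal (I i) R" if "i \<le> k" for i
    using I that by (simp add: comaximal_ideals_def)
  have "\<exists>a. a \<in> GCD_tuples R k \<and> f i = PF_class R k (m i) (I i) a" if "i \<le> k" for i
  proof -
    have "f i \<in> PF R k (m i) (I i)" using f that by auto
    then show ?thesis unfolding PF_def PF_class_def by (elim quotientE) blast
  qed
  then obtain x where x: "\<And>i. i \<le> k \<Longrightarrow> x i \<in> GCD_tuples R k"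
    and fx: "\<And>i. i \<le> k \<Longrightarrow> f i = PF_class R k (m i) (I i) (x i)" by metis
  have xc: "x i j \<in> carrier R" if "i \<le> k" "j \<le> k" for i j
    using x[OF that(1)] that(2) by (auto simp: GCD_tuples_def tuples_def)
  have "\<exists>j\<le>k. x i j \<notin> M" if "i \<le> k" and M: "maximalideal M R" for i M
    using x[OF that(1)] maximalideal.axioms(1)[OF M] maximalideal.I_notcarr[OF M]
    unfolding GCD_tuples_iff by metis
  then have "\<exists>A. (\<forall>i\<le>k. \<forall>j\<le>k. A i j \<in> carrier R) \<and> determinant R k A = \<one> \<and>
      (\<forall>i\<le>k. \<forall>j\<le>k. I i +> A i j = I i +> x i j)"
    using exists_determinant_one_mod_ideals[OF I fin k, of x] xc by blast
  then obtain A where Ac: "\<And>i j. i \<le> k \<Longrightarrow> j \<le> k \<Longrightarrow> A i j \<in> carrier R"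
    and det: "determinant R k A = \<one>"
    and Ax: "\<And>i j. i \<le> k \<Longrightarrow> j \<le> k \<Longrightarrow> I i +> A i j = I i +> x i j"
    by blast
  let ?A = "\<lambda>i\<in>{..k}. \<lambda>j\<in>{..k}. A i j"
  have "determinant R k A = determinant R k ?A"
    by (rule determinant_cong) (use Ac in auto)
  with det have SL: "?A \<in> SL R k" using Ac by (auto simp: SL_def tuples_def)
  have "PF_class R k (m i) (I i) (?A i) = f i" if i: "i \<le> k" for i
  proof -
    interpret Ii: ideal "I i" R by (rule I_ideal[OF i])
    interpret Q: cring "R Quot I i" by (rule Ii.quotient_is_cring[OF is_cring])
    interpret h: ring_hom_ring R "R Quot I i" "(+>) (I i)" by (rule Ii.rcos_ring_hom_ring)
    have "A i j \<ominus> \<one> [^] m i j \<otimes> x i j \<in> I i" if j: "j \<le> k" for j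
      using quotient_eq_iff_same_a_r_cos[OF Ii.is_ideal, of "A i j" "x i j"]
        Ac[OF i j] xc[OF i j] Ax[OF i j] by simp
    moreover have "I i +> \<one> \<in> Units (R Quot I i)" by simp
    ultimately have "(?A i, x i) \<in> PF_rel R k (m i) (I i)"
      unfolding PF_rel_def using SL_row_in_GCD_tuples[OF SL i] x[OF i] i
      by (auto intro!: bexI[of _ \<one>])
    then show ?thesis
      unfolding fx[OF i] PF_class_def by (rule equiv_class_eq[OF equiv_PF_rel[OF Ii.is_ideal]])
  qed
  then have "row_map R k m I ?A = f"
    using f by (intro ext) (auto simp: row_map_def PiE_def extensional_def)
  with SL show "f \<in> row_map R k m I ` SL R k" by blast
qed

end

theorem mainTheorem3:
  fixes R :: "('a, 'b) ring_scheme" and k :: nat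
  assumes "cring R" and "1 \<le> k"
  shows
    "(\<forall>I m. comaximal_ideals R k I \<and> (\<forall>i\<le>k. finitely_many_maximal_over R (I i)) \<and>
        admissible_weights k m \<longrightarrow>
        row_map R k m I ` SL R k = (\<Pi>\<^sub>E i\<in>{..k}. PF R k (m i) (I i)))
   \<and> (\<forall>I m. comaximal_ideals R k I \<and> (\<forall>i\<le>k. finitely_many_maximal_over R (I i)) \<and>
        (\<forall>i\<le>k. \<forall>j\<le>k. m i j = 1) \<longrightarrow>
        row_map R k m I ` SL R k = (\<Pi>\<^sub>E i\<in>{..k}. PF R k (m i) (I i)))
   \<and> (\<forall>I m. comaximal_ideals R k I \<and> primary_type_products R k I \<and>
        admissible_weights k m \<longrightarrow>
        row_map R k m I ` SL R k = (\<Pi>\<^sub>E i\<in>{..k}. PF R k (m i) (I i)))"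
proof -
  interpret cring R by (rule assms(1))
  note surj = row_map_surjective[OF assms(2)]
  show ?thesis
    by (intro conjI allI impI; elim conjE; rule surj)
      (auto intro: primary_type_products_finitely_many_maximal)
qed

end
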